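(* Let $n>1$ be an integer and let $x,y\in\mathbf{F}^n$. Then there exists a finite set $S_{xy}\subseteq\mathbf{F}^n$ containing $x$ and $y$ such that every map $f:S_{xy}\to\mathbb{R}^n$ preserving all unit distances satisfies $|f(x)-f(y)|=|x-y|$.
   Context: $\mathbf{F}\subseteq\mathbb{R}$ denotes the field of real numbers constructible by means of ruler and compass (equivalently, the smallest subfield of $\mathbb{R}$ closed under taking square roots of its non-negative elements). $|\cdot|$ is the Euclidean norm on $\mathbb{R}^n$. A map $f:S\to\mathbb{R}^n$ with $S\subseteq\mathbb{R}^n$ preserves all unit distances if for all $u,v\in S$, $|u-v|=1$ implies $|f(u)-f(v)|=1$. Maps are arbitrary functions (no continuity or injectivity is assumed). *)

theory Defs
  imports "HOL-Analysis.Analysis"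
begin

(* The smallest subfield of the reals closed under square roots of its
   non-negative elements, i.e. the real numbers constructible by ruler and
   compass.  No side condition is needed for inverses, as inverse 0 = 0. *)
inductive_set constructible :: "real set" where
  one: "1 \<in> constructible"
| diff: "a \<in> constructible \<Longrightarrow> b \<in> constructible \<Longrightarrow> a - b \<in> constructible"
| mult: "a \<in> constructible \<Longrightarrow> b \<in> constructible \<Longrightarrow> a * b \<in> constructible"
| inverse: "a \<in> constructible \<Longrightarrow> inverse a \<in> constructible"
| sqrt: "a \<in> constructible \<Longrightarrow> a \<ge> 0 \<Longrightarrow> sqrt a \<in> constructible"

definition constructible_points :: "(real ^ 'n::finite) set" where
  "constructible_points = {x. \<forall>i. x $ i \<in> constructible}"

(* A map with domain S is represented by a total function;
   only its values on S matter. *)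
definition preserves_unit_distances ::
    "(real ^ 'n::finite) set \<Rightarrow> (real ^ 'n \<Rightarrow> real ^ 'n) \<Rightarrow> bool" where
  "preserves_unit_distances S f \<longleftrightarrow>
     (\<forall>u\<in>S. \<forall>v\<in>S. norm (u - v) = 1 \<longrightarrow> norm (f u - f v) = 1)"

end

(* Call a property of maps forced if some finite constructible set forces it on all maps that
   preserve its unit distances, and call a distance d good if its preservation is forced for all
   constructible pairs at distance d.  By transitivity of the constructible isometries one pair
   suffices, so good distances are closed under multiplication.

   In dimension n a point equidistant from the n vertices of a regular (n-1)-simplex is determined
   up to reflection in the hyperplane of the simplex.  This makes sqrt (2 (n+1) / n) good, and then
   2 by a chain of short segments.  Goodness of 2 forces midpoints; Apollonius' median theorem
   gives closure under sqrt (a^2 - b^2) and sqrt (a^2 + b^2), and forced similar triangles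
   give 1/2.  Two points over the same simplex at heights a and b then yield a - b and a + b,
   similar triangles yield inverses, and sqrt a is a leg of a right triangle with
   sides (a + 1) / 2 and (a - 1) / 2.  So every positive constructible number is good. *)

theory Submission
  imports Defs
begin

section \<open>Constructible numbers and points\<close>

lemma constructible_0 [simp]: "0 \<in> constructible"
  using constructible.diff[OF constructible.one constructible.one] by simp

lemma constructible_1 [simp]: "1 \<in> constructible"
  by (rule constructible.one)

lemma constructible_minus: "a \<in> constructible \<Longrightarrow> - a \<in> constructible"
  using constructible.diff[OF constructible_0] by fastforce

lemma constructible_add:
  assumes "a \<in> constructible" "b \<in> constructible"
  shows "a + b \<in> constructible"
  using constructible.diff[OF assms(1) constructible_minus[OF assms(2)]] by simp

lemma constructible_divide:
  "a \<in> constructible \<Longrightarrow> b \<in> constructible \<Longrightarrow> a / b \<in> constructible"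
  by (simp add: divide_inverse constructible.mult constructible.inverse)

lemma constructible_of_nat [simp]: "of_nat n \<in> constructible"
  by (induction n) (auto intro: constructible_add)

lemma constructible_numeral [simp]: "numeral n \<in> constructible"
  using constructible_of_nat[of "numeral n"] by simp

lemma constructible_power: "a \<in> constructible \<Longrightarrow> a ^ n \<in> constructible"
  by (induction n) (auto intro: constructible.mult)

lemma constructible_sum: "(\<And>i. i \<in> A \<Longrightarrow> g i \<in> constructible) \<Longrightarrow> sum g A \<in> constructible"
  by (induction A rule: infinite_finite_induct) (auto intro: constructible_add)

lemmas constructible_intros =
  constructible_add constructible.diff constructible.mult constructible.sqrt
  constructible_divide constructible_minus constructible_power

lemma constructible_pointsI: "(\<And>i. x $ i \<in> constructible) \<Longrightarrow> x \<in> constructible_points"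
  by (simp add: constructible_points_def)

lemma constructible_pointsD: "x \<in> constructible_points \<Longrightarrow> x $ i \<in> constructible"
  by (simp add: constructible_points_def)

lemma constructible_points_0 [simp]: "0 \<in> constructible_points"
  by (simp add: constructible_points_def)

lemma constructible_points_axis: "a \<in> constructible \<Longrightarrow> axis i a \<in> constructible_points"
  by (simp add: constructible_points_def axis_def)

lemma constructible_points_vec: "a \<in> constructible \<Longrightarrow> vec a \<in> constructible_points"
  by (simp add: constructible_points_def)

lemma constructible_points_add:
  "x \<in> constructible_points \<Longrightarrow> y \<in> constructible_points \<Longrightarrow> x + y \<in> constructible_points"
  by (simp add: constructible_points_def constructible_add)

lemma constructible_points_diff:
  "x \<in> constructible_points \<Longrightarrow> y \<in> constructible_points \<Longrightarrow> x - y \<in> constructible_points"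
  by (simp add: constructible_points_def constructible.diff)

lemma constructible_points_scaleR:
  "a \<in> constructible \<Longrightarrow> x \<in> constructible_points \<Longrightarrow> a *\<^sub>R x \<in> constructible_points"
  by (simp add: constructible_points_def constructible.mult)

lemmas constructible_points_intros =
  constructible_points_axis constructible_points_vec constructible_points_add
  constructible_points_diff constructible_points_scaleR

section \<open>Constructible norms, isometries and isosceles triangles\<close>

lemma norm_axis: "norm (axis i a :: real ^ 'n::finite) = \<bar>a\<bar>"
  by (simp add: norm_eq_sqrt_inner inner_axis_axis)

lemma constructible_inner:
  "x \<in> constructible_points \<Longrightarrow> y \<in> constructible_points \<Longrightarrow> x \<bullet> y \<in> constructible"
  unfolding inner_vec_def
  by (auto intro!: constructible_sum constructible.mult dest: constructible_pointsD)

lemma constructible_norm: "x \<in> constructible_points \<Longrightarrow> norm x \<in> constructible"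
  by (simp add: norm_eq_sqrt_inner constructible.sqrt constructible_inner)

text \<open>The Householder reflection exchanging two vectors of equal length has constructible
  coefficients, so the constructible isometries act transitively on pairs at a given distance.\<close>

lemma constructible_isometry:
  fixes x y x' y' :: "real ^ 'n::finite"
  assumes "x \<in> constructible_points" "y \<in> constructible_points"
    and "x' \<in> constructible_points" "y' \<in> constructible_points"
    and eq: "norm (x - y) = norm (x' - y')"
  obtains T where "T ` constructible_points \<subseteq> constructible_points"
    "\<And>u v. norm (T u - T v) = norm (u - v)" "T x = x'" "T y = y'"
proof -
  define a where "a = y - x"
  define b where "b = y' - x'"
  define w where "w = a - b"
  \<comment> \<open>Reflection in the hyperplane orthogonal to \<open>w\<close>. If
    \<open>a = b\<close>, then \<open>w = 0\<close> and \<open>H\<close> is the identity.\<close>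
  define H where "H p = p - (2 * (w \<bullet> p) / (w \<bullet> w)) *\<^sub>R w" for p
  define T where "T p = x' + H (p - x)" for p
  have ab: "a \<bullet> a = b \<bullet> b"
    using eq by (simp add: a_def b_def norm_minus_commute flip: power2_norm_eq_inner)
  have F: "a \<in> constructible_points" "b \<in> constructible_points" "w \<in> constructible_points"
    using assms by (auto simp: a_def b_def w_def intro!: constructible_points_intros)
  have Ha: "H a = b"
  proof (cases "w = 0")
    case False
    then have nz: "w \<bullet> w \<noteq> 0" by simp
    \<comment> \<open>Since \<open>a\<close> and \<open>b\<close> have equal length, the reflection
      subtracts exactly \<open>w\<close> from \<open>a\<close>.\<close>
    have "w \<bullet> w = 2 * (w \<bullet> a)"
      using ab by (simp add: w_def inner_diff_left inner_diff_right inner_commute)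
    then have "2 * (w \<bullet> a) / (w \<bullet> w) = 1"
      using nz by (metis divide_self)
    then have "H a = a - w" by (simp only: H_def scaleR_one)
    then show ?thesis by (simp add: w_def)
  qed (simp add: H_def w_def)
  have H_diff: "H u - H v = H (u - v)" for u v
    by (simp add: H_def inner_diff_right right_diff_distrib diff_divide_distrib scaleR_diff_left)
  have H_norm: "norm (H u) = norm u" for u
  proof -
    have "H u \<bullet> H u = u \<bullet> u"
      by (cases "w = 0")
        (simp_all add: H_def inner_diff_left inner_diff_right inner_commute field_simps)
    then show ?thesis by (simp add: norm_eq_sqrt_inner)
  qed
  show thesis
  proof (rule that)
    show "T ` constructible_points \<subseteq> constructible_points"
      using assms F by (auto simp: T_def H_def
          intro!: constructible_points_intros constructible_intros constructible_inner)
    show "norm (T u - T v) = norm (u - v)" for u v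
      by (simp add: T_def H_diff H_norm)
    show "T x = x'" by (simp add: T_def H_def)
    show "T y = y'" using Ha by (simp add: T_def a_def b_def)
  qed
qed

lemma obtain_constructible_pair:
  assumes "d \<in> constructible" "d \<ge> 0"
  obtains x y :: "real ^ 'n::finite" where "x \<in> constructible_points" "y \<in> constructible_points"
    "norm (x - y) = d"
  using assms that[of "axis undefined d" 0] by (simp add: constructible_points_axis norm_axis)

text \<open>In a coordinate plane the apex lies at height \<open>s\<close> over the midpoint of the
  base, by Pythagoras; a constructible isometry then moves the base to the given pair. Dimension
  above 1 supplies the second axis.\<close>

lemma constructible_isosceles:
  fixes x y :: "real ^ 'n::finite"
  assumes n: "CARD('n) > 1"
    and xy: "x \<in> constructible_points" "y \<in> constructible_points"
    and g: "g \<in> constructible" "norm (x - y) \<le> 2 * g"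
  obtains z where "z \<in> constructible_points" "norm (x - z) = g" "norm (y - z) = g"
proof -
  obtain i j :: 'n where ij: "i \<noteq> j"
    using n by (metis UNIV_I card_le_Suc0_iff_eq finite One_nat_def not_less)
  define d where "d = norm (x - y)"
  have d: "d \<in> constructible" "d \<ge> 0"
    using xy by (auto simp: d_def intro!: constructible_norm constructible_points_intros)
  define s where "s = sqrt (g\<^sup>2 - (d / 2)\<^sup>2)"
  have le: "(d / 2)\<^sup>2 \<le> g\<^sup>2"
    using g d by (intro power_mono) (auto simp: d_def)
  have s: "s \<in> constructible" "s\<^sup>2 = g\<^sup>2 - (d / 2)\<^sup>2"
    using le g d by (auto simp: s_def intro!: constructible_intros)
  have g0: "g \<ge> 0" using g norm_ge_zero[of "x - y"] by linarith
  define p q m :: "real ^ 'n" where "p = axis i 0" and "q = axis i d" and "m = axis i (d / 2) + axis j s"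
  have pqm: "p \<in> constructible_points" "q \<in> constructible_points" "m \<in> constructible_points"
    using d s by (auto simp: p_def q_def m_def intro!: constructible_points_intros constructible_intros)
  have axis0: "axis i (0::real) = 0" by (simp add: axis_def vec_eq_iff)
  have qm: "q - m = axis i (d / 2) - axis j s"
    by (simp add: q_def m_def axis_def vec_eq_iff)
  have "(norm (p - m))\<^sup>2 = g\<^sup>2" "(norm (q - m))\<^sup>2 = g\<^sup>2"
    unfolding qm power2_norm_eq_inner using ij s(2)
    by (auto simp: p_def m_def axis0 inner_diff_left inner_diff_right
        inner_axis_axis inner_add_left inner_add_right power2_eq_square)
  then have nm: "norm (p - m) = g" "norm (q - m) = g"
    using g0 by (auto simp: power2_eq_iff_nonneg)
  have "norm (p - q) = norm (x - y)"
    using d by (simp add: p_def q_def axis0 norm_axis flip: d_def)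
  then obtain T where T: "T ` constructible_points \<subseteq> constructible_points"
    "\<And>u v. norm (T u - T v) = norm (u - v)" "T p = x" "T q = y"
    using constructible_isometry[OF pqm(1,2) xy] by metis
  show thesis
    using that[of "T m"] T(1) pqm(3) nm T(2)[of p m] T(2)[of q m] T(3,4) by auto
qed

section \<open>Forced properties of unit-distance preserving maps\<close>

text \<open>A property holds eventually along this filter iff some finite constructible set forces it
  on all maps that preserve unit distances on that set.\<close>

definition unit_maps :: "(real ^ 'n::finite \<Rightarrow> real ^ 'n) filter" where
  "unit_maps = (INF S\<in>{S. finite S \<and> S \<subseteq> constructible_points}.
                  principal {f. preserves_unit_distances S f})"

text \<open>Unions make the index sets directed: \<open>A \<union> B\<close> forces whatever
  \<open>A\<close> or \<open>B\<close> forces. Hence a forced property has a single finite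
  witness.\<close>

lemma eventually_unit_maps:
  "eventually P unit_maps \<longleftrightarrow>
     (\<exists>S. finite S \<and> S \<subseteq> constructible_points \<and> (\<forall>f. preserves_unit_distances S f \<longrightarrow> P f))"
  unfolding unit_maps_def
proof (subst eventually_INF_base)
  fix A B :: "(real ^ 'n) set"
  assume "A \<in> {S. finite S \<and> S \<subseteq> constructible_points}"
    "B \<in> {S. finite S \<and> S \<subseteq> constructible_points}"
  then show "\<exists>C\<in>{S. finite S \<and> S \<subseteq> constructible_points}.
      principal {f. preserves_unit_distances C f}
      \<le> inf (principal {f. preserves_unit_distances A f})
          (principal {f. preserves_unit_distances B f})"
    by (intro bexI[of _ "A \<union> B"]) (auto simp: preserves_unit_distances_def)
qed (auto simp: eventually_principal)

lemma eventually_unit_maps_transfer: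
  fixes x y x' y' :: "real ^ 'n::finite"
  assumes "x \<in> constructible_points" "y \<in> constructible_points"
    and "x' \<in> constructible_points" "y' \<in> constructible_points"
    and "norm (x - y) = norm (x' - y')"
    and "\<forall>\<^sub>F f in unit_maps. R (norm (f x - f y))"
  shows "\<forall>\<^sub>F f in unit_maps. R (norm (f x' - f y'))"
proof -
  obtain T where T: "T ` constructible_points \<subseteq> constructible_points"
    "\<And>u v. norm (T u - T v) = norm (u - v)" "T x = x'" "T y = y'"
    using constructible_isometry[OF assms(1-5)] by metis
  obtain S where S: "finite S" "S \<subseteq> constructible_points"
    "\<And>f. preserves_unit_distances S f \<Longrightarrow> R (norm (f x - f y))"
    using assms(6) by (auto simp: eventually_unit_maps)
  have "R (norm (f x' - f y'))" if "preserves_unit_distances (T ` S) f" for f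
    using S(3)[of "f \<circ> T"] that T by (auto simp: preserves_unit_distances_def)
  then show ?thesis
    unfolding eventually_unit_maps using S(1,2) T(1) by (intro exI[of _ "T ` S"]) blast
qed

section \<open>Good distances and their products\<close>

text \<open>The type argument carries the dimension, which the type of \<open>d\<close> cannot show.
  The forcing set may depend on the pair.\<close>

definition good :: "'n::finite itself \<Rightarrow> real \<Rightarrow> bool" where
  "good _ d \<longleftrightarrow> d > 0 \<and> d \<in> constructible \<and>
     (\<forall>x y :: real ^ 'n. x \<in> constructible_points \<longrightarrow> y \<in> constructible_points \<longrightarrow>
        norm (x - y) = d \<longrightarrow> (\<forall>\<^sub>F f in unit_maps. norm (f x - f y) = d))"

lemma good_pos: "good N d \<Longrightarrow> d > 0"
  and good_constructible: "good N d \<Longrightarrow> d \<in> constructible"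
  by (simp_all add: good_def)

lemma goodD:
  fixes x y :: "real ^ 'n::finite"
  assumes "good TYPE('n) d" "x \<in> constructible_points" "y \<in> constructible_points"
    "norm (x - y) = d"
  shows "\<forall>\<^sub>F f in unit_maps. norm (f x - f y) = d"
  using assms by (simp add: good_def)

lemma goodI:
  fixes x y :: "real ^ 'n::finite"
  assumes "d > 0" "x \<in> constructible_points" "y \<in> constructible_points"
    "norm (x - y) = d" "\<forall>\<^sub>F f in unit_maps. norm (f x - f y) = d"
  shows "good TYPE('n) d"
  unfolding good_def
proof (intro conjI allI impI)
  show "d \<in> constructible"
    using constructible_norm[OF constructible_points_diff[OF assms(2,3)]] assms(4) by simp
  show "\<forall>\<^sub>F f in unit_maps. norm (f x' - f y') = d"
    if "x' \<in> constructible_points" "y' \<in> constructible_points" "norm (x' - y') = d"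
    for x' y' :: "real ^ 'n"
    using eventually_unit_maps_transfer[OF assms(2,3) that(1,2), of "\<lambda>t. t = d"] assms that by simp
qed fact

lemma good_1: "good TYPE('n::finite) 1"
proof -
  obtain x y :: "real ^ 'n" where xy: "x \<in> constructible_points" "y \<in> constructible_points"
    "norm (x - y) = 1"
    by (rule obtain_constructible_pair[of 1]) auto
  have "\<forall>\<^sub>F f in unit_maps. norm (f x - f y) = 1"
    unfolding eventually_unit_maps
    using xy by (intro exI[of _ "{x, y}"]) (auto simp: preserves_unit_distances_def)
  then show ?thesis using xy by (intro goodI[of _ x y]) auto
qed

text \<open>A finite set forcing the distance \<open>b\<close>, scaled by a good \<open>a\<close>, forces \<open>a * b\<close>.\<close>

lemma good_mult:
  assumes a: "good TYPE('n::finite) a" and b: "good TYPE('n) b"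
  shows "good TYPE('n) (a * b)"
proof -
  have pos: "a > 0" "b > 0" using a b good_pos by blast+
  have Fa: "a \<in> constructible" using a by (rule good_constructible)
  obtain x y :: "real ^ 'n" where xy: "x \<in> constructible_points" "y \<in> constructible_points"
    "norm (x - y) = b"
    using obtain_constructible_pair[of b] good_constructible[OF b] pos by (metis less_imp_le)
  obtain S where S: "finite S" "S \<subseteq> constructible_points"
    "\<And>f. preserves_unit_distances S f \<Longrightarrow> norm (f x - f y) = b"
    using goodD[OF b xy] by (auto simp: eventually_unit_maps)
  have "\<forall>\<^sub>F f in unit_maps. norm (u - v) = 1 \<longrightarrow> norm (f (a *\<^sub>R u) - f (a *\<^sub>R v)) = a"
    if "u \<in> S" "v \<in> S" for u v
  proof (cases "norm (u - v) = 1")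
    case True
    have "norm (a *\<^sub>R u - a *\<^sub>R v) = a"
      using True pos by (simp flip: scaleR_diff_right)
    then show ?thesis
      using goodD[OF a, of "a *\<^sub>R u" "a *\<^sub>R v"] that S(2) Fa True
      by (auto intro: constructible_points_scaleR)
  qed simp
  then have "\<forall>\<^sub>F f in unit_maps. \<forall>u\<in>S. \<forall>v\<in>S.
      norm (u - v) = 1 \<longrightarrow> norm (f (a *\<^sub>R u) - f (a *\<^sub>R v)) = a"
    using S(1) by (intro eventually_ball_finite ballI) auto
  then have "\<forall>\<^sub>F f in unit_maps. norm (f (a *\<^sub>R x) - f (a *\<^sub>R y)) = a * b"
  proof eventually_elim
    case (elim f)
    \<comment> \<open>Conjugation by the homothety of ratio \<open>a\<close> turns preservation of
      \<open>a\<close> on the scaled set into preservation of 1 on \<open>S\<close>.\<close>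
    define g where "g p = f (a *\<^sub>R p) /\<^sub>R a" for p
    have g: "norm (g u - g v) = norm (f (a *\<^sub>R u) - f (a *\<^sub>R v)) / a" for u v
      using pos by (simp add: g_def divide_inverse flip: scaleR_diff_right)
    have "preserves_unit_distances S g"
      using elim pos by (simp add: preserves_unit_distances_def g)
    from S(3)[OF this] show ?case
      using pos by (simp add: g field_simps)
  qed
  then show ?thesis
    using pos xy Fa
    by (intro goodI[of _ "a *\<^sub>R x" "a *\<^sub>R y"])
      (auto intro: constructible_points_scaleR simp flip: scaleR_diff_right)
qed

section \<open>Apexes over a regular simplex\<close>

text \<open>The vectors \<open>q i - a\<close> have a positive definite Gram matrix, so they span the space and
  \<open>b - a\<close> is the multiple of their sum that the distances from \<open>b\<close> prescribe.\<close>

lemma dist_simplex_apexes: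
  fixes q :: "'n::finite \<Rightarrow> real ^ 'n" and a b :: "real ^ 'n"
  assumes beta: "\<beta> > 0" and h: "h \<noteq> 0"
    and qq: "\<And>i j. i \<noteq> j \<Longrightarrow> (norm (q i - q j))\<^sup>2 = 2 * \<beta>\<^sup>2"
    and qa: "\<And>i. (norm (a - q i))\<^sup>2 = h\<^sup>2 + \<beta>\<^sup>2 * (1 - 1 / CARD('n))"
    and qb: "\<And>i. (norm (b - q i))\<^sup>2 = k\<^sup>2 + \<beta>\<^sup>2 * (1 - 1 / CARD('n))"
  shows "norm (a - b) = \<bar>h - k\<bar> \<or> norm (a - b) = \<bar>h + k\<bar>"
proof -
  define N where "N = real CARD('n)"
  have N: "N > 0" by (simp add: N_def)
  define v where "v i = q i - a" for i
  define w where "w = (\<Sum>j\<in>UNIV. v j)"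
  define d where "d = b - a"
  define \<sigma> where "\<sigma> = norm d"
  \<comment> \<open>The common value of all \<open>v i \<bullet> d\<close>, found by polarization in
    \<open>vd\<close>.\<close>
  define \<kappa> where "\<kappa> = (\<sigma>\<^sup>2 + h\<^sup>2 - k\<^sup>2) / 2"
  have vv: "v i \<bullet> v i = h\<^sup>2 + \<beta>\<^sup>2 * (1 - 1 / N)" for i
    using qa[of i] by (simp add: v_def N_def norm_minus_commute flip: power2_norm_eq_inner)
  have polar: "2 * (x \<bullet> y) = x \<bullet> x + y \<bullet> y - (norm (x - y))\<^sup>2" for x y :: "real ^ 'n"
    by (simp add: power2_norm_eq_inner inner_diff_left inner_diff_right inner_commute)
  have gram: "v i \<bullet> v j = (h\<^sup>2 - \<beta>\<^sup>2 / N) + (if j = i then \<beta>\<^sup>2 else 0)" for i j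
  proof (cases "i = j")
    case True
    then show ?thesis using vv[of i] by (simp add: algebra_simps)
  next
    case False
    have "v i - v j = q i - q j" by (simp add: v_def)
    then have "2 * (v i \<bullet> v j) = 2 * (h\<^sup>2 + \<beta>\<^sup>2 * (1 - 1 / N)) - 2 * \<beta>\<^sup>2"
      using polar[of "v i" "v j"] qq[OF False] vv[of i] vv[of j] by simp
    then show ?thesis using False by (auto simp: algebra_simps)
  qed
  have Nh: "N * (h\<^sup>2 - \<beta>\<^sup>2 / N) + \<beta>\<^sup>2 = N * h\<^sup>2"
    using N by (simp add: field_simps)
  have vw: "v i \<bullet> w = N * h\<^sup>2" for i
    using Nh by (simp add: w_def inner_sum_right gram sum.distrib N_def)
  \<comment> \<open>A linear relation among the \<open>v i\<close>, paired with \<open>w\<close>,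
    has coefficient sum 0; paired with \<open>v j\<close>, it then gives \<open>c j = 0\<close>. So
    the matrix with these rows is invertible and has trivial kernel.\<close>
  have orth: "z = 0" if z: "\<And>i. v i \<bullet> z = 0" for z
  proof -
    define M where "M = (\<chi> i. v i)"
    have "\<forall>i. c i = 0" if c: "(\<Sum>i\<in>UNIV. c i *s row i M) = 0" for c
    proof -
      have c0: "(\<Sum>i\<in>UNIV. c i *\<^sub>R v i) = 0"
        using c by (simp add: M_def row_def vec_nth_inverse scalar_mult_eq_scaleR)
      have "(\<Sum>i\<in>UNIV. c i) * (N * h\<^sup>2) = (\<Sum>i\<in>UNIV. c i *\<^sub>R v i) \<bullet> w"
        by (simp add: inner_sum_left vw sum_distrib_right)
      then have C: "(\<Sum>i\<in>UNIV. c i) = 0"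
        using c0 N h by simp
      have "c j * \<beta>\<^sup>2 = 0" for j
      proof -
        have "0 = (\<Sum>i\<in>UNIV. c i *\<^sub>R v i) \<bullet> v j" using c0 by simp
        also have "\<dots> = (\<Sum>i\<in>UNIV. c i * (h\<^sup>2 - \<beta>\<^sup>2 / N) + (if i = j then c j * \<beta>\<^sup>2 else 0))"
          unfolding inner_sum_left by (intro sum.cong) (auto simp: gram algebra_simps)
        also have "\<dots> = c j * \<beta>\<^sup>2"
          using C by (simp add: sum.distrib flip: sum_distrib_right)
        finally show ?thesis by simp
      qed
      then show ?thesis using beta by simp
    qed
    then have "\<exists>B. M ** B = mat 1"
      by (simp add: matrix_right_invertible_independent_rows)
    then have "\<exists>B. B ** M = mat 1"
      by (metis matrix_left_right_inverse)
    moreover have "M *v z = 0"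
      using z by (simp add: M_def vec_eq_iff matrix_vector_mult_def inner_vec_def)
    ultimately show ?thesis
      using matrix_left_invertible_ker by blast
  qed
  have vd: "v i \<bullet> d = \<kappa>" for i
  proof -
    have "v i - d = q i - b" by (simp add: v_def d_def)
    then show ?thesis
      using polar[of "v i" d] vv[of i] qb[of i]
      by (simp add: \<kappa>_def \<sigma>_def N_def norm_minus_commute power2_norm_eq_inner)
  qed
  have "(N * h\<^sup>2) *\<^sub>R d - \<kappa> *\<^sub>R w = 0"
    by (rule orth) (simp add: inner_diff_right vd vw)
  then have eq: "(N * h\<^sup>2) *\<^sub>R d = \<kappa> *\<^sub>R w" by simp
  have "w \<bullet> w = N * (N * h\<^sup>2)"
    unfolding w_def inner_sum_left by (subst vw[unfolded w_def]) (simp add: N_def)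
  then have "(N * h\<^sup>2)\<^sup>2 * \<sigma>\<^sup>2 = \<kappa>\<^sup>2 * (N * (N * h\<^sup>2))"
    using arg_cong[OF eq, of "\<lambda>u. u \<bullet> u"]
    unfolding \<sigma>_def power2_norm_eq_inner by (simp add: power2_eq_square algebra_simps)
  then have "(N\<^sup>2 * h\<^sup>2) * (h\<^sup>2 * \<sigma>\<^sup>2 - \<kappa>\<^sup>2) = 0"
    by (simp add: power2_eq_square algebra_simps)
  then have "h\<^sup>2 * \<sigma>\<^sup>2 = \<kappa>\<^sup>2" using N h by simp
  \<comment> \<open>Heron's factorization: four times the difference of the two sides above is 16
    times the squared area of a triangle with sides \<open>\<bar>h\<bar>\<close>,
    \<open>\<bar>k\<bar>\<close>, \<open>\<sigma>\<close>, which must be degenerate.\<close>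
  then have "(\<sigma> - (h - k)) * (\<sigma> - (h + k)) * (\<sigma> + (h - k)) * (\<sigma> + (h + k)) = 0"
    unfolding \<kappa>_def by (simp add: power2_eq_square field_simps)
  then have "\<sigma> = h - k \<or> \<sigma> = h + k \<or> \<sigma> = - (h - k) \<or> \<sigma> = - (h + k)"
    by (auto simp: eq_neg_iff_add_eq_0)
  moreover have "\<sigma> \<ge> 0" "norm (a - b) = \<sigma>"
    by (simp_all add: \<sigma>_def d_def norm_minus_commute)
  ultimately show ?thesis by arith
qed

text \<open>Heights are signed, and the image of the simplex leaves open on which side each apex
  lands; this is the source of the two alternatives. One explicit model suffices by
  transfer.\<close>

lemma eventually_simplex_apexes:
  fixes x y :: "real ^ 'n::finite"
  assumes beta: "\<beta> > 0" "good TYPE('n) (sqrt 2 * \<beta>)" and hk: "h \<noteq> 0" "h \<in> constructible" "k \<in> constructible"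
    and h: "good TYPE('n) (sqrt (h\<^sup>2 + \<beta>\<^sup>2 * (1 - 1 / CARD('n))))"
    and k: "good TYPE('n) (sqrt (k\<^sup>2 + \<beta>\<^sup>2 * (1 - 1 / CARD('n))))"
    and xy: "x \<in> constructible_points" "y \<in> constructible_points" "norm (x - y) = \<bar>h - k\<bar>"
  shows "\<forall>\<^sub>F f in unit_maps. norm (f x - f y) = \<bar>h - k\<bar> \<or> norm (f x - f y) = \<bar>h + k\<bar>"
proof -
  define N where "N = real CARD('n)"
  have N: "N > 0" by (simp add: N_def)
  have "(sqrt 2 * \<beta>) / sqrt 2 \<in> constructible"
    using good_constructible[OF beta(2)] by (intro constructible_divide constructible.sqrt) auto
  then have F\<beta>: "\<beta> \<in> constructible" by simp
  \<comment> \<open>The scaled basis vectors span a regular simplex of edge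
    \<open>sqrt 2 * \<beta>\<close> with centroid \<open>vec (\<beta> / N)\<close>;
    \<open>P t\<close> lies at signed height \<open>t\<close> along the unit normal
    \<open>vec (1 / sqrt N)\<close>.\<close>
  define q :: "'n \<Rightarrow> real ^ 'n" where "q i = axis i \<beta>" for i
  define P :: "real \<Rightarrow> real ^ 'n" where "P t = vec (\<beta> / N + t / sqrt N)" for t
  have Fq: "q i \<in> constructible_points" for i
    by (simp add: q_def constructible_points_axis F\<beta>)
  have FP: "P t \<in> constructible_points" if "t \<in> constructible" for t
    using that F\<beta> N by (auto simp: P_def N_def intro!: constructible_points_vec constructible_intros)
  have vv: "vec c \<bullet> (vec c :: real ^ 'n) = N * c\<^sup>2" for c
    by (simp add: inner_vec_def N_def power2_eq_square)
  have va: "vec c \<bullet> axis i e = c * e" for c e and i :: 'n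
    by (simp add: inner_axis)
  have qq: "norm (q i - q j) = sqrt 2 * \<beta>" if "i \<noteq> j" for i j
  proof -
    have "(norm (q i - q j))\<^sup>2 = (sqrt 2 * \<beta>)\<^sup>2"
      unfolding power2_norm_eq_inner using that
      by (simp add: q_def inner_diff_left inner_diff_right inner_axis_axis power_mult_distrib power2_eq_square)
    then show ?thesis using beta by (simp add: power2_eq_iff_nonneg)
  qed
  have Pq: "norm (P t - q i) = sqrt (t\<^sup>2 + \<beta>\<^sup>2 * (1 - 1 / CARD('n)))" for t i
  proof -
    define c where "c = \<beta> / N + t / sqrt N"
    have Nc: "N * c = \<beta> + sqrt N * t"
      using N real_div_sqrt[of N] by (simp add: c_def distrib_left flip: times_divide_eq_left)
    have "N * (N * c\<^sup>2 - 2 * c * \<beta> + \<beta>\<^sup>2) = (N * c)\<^sup>2 - 2 * (N * c) * \<beta> + N * \<beta>\<^sup>2"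
      by (simp add: power2_eq_square algebra_simps)
    also have "\<dots> = N * (t\<^sup>2 + \<beta>\<^sup>2 * (1 - 1 / N))"
      unfolding Nc using N by (simp add: power2_eq_square field_simps)
    finally have "N * c\<^sup>2 - 2 * c * \<beta> + \<beta>\<^sup>2 = t\<^sup>2 + \<beta>\<^sup>2 * (1 - 1 / N)"
      using N by simp
    moreover have "(P t - q i) \<bullet> (P t - q i) = N * c\<^sup>2 - 2 * c * \<beta> + \<beta>\<^sup>2"
      by (simp add: P_def q_def inner_diff_left inner_diff_right vv va inner_axis_axis
          inner_commute[of "axis i \<beta>"] power2_eq_square flip: c_def)
    ultimately show ?thesis by (simp add: norm_eq_sqrt_inner N_def)
  qed
  have PP: "norm (P h - P k) = \<bar>h - k\<bar>"
  proof -
    have "P h - P k = vec ((h - k) / sqrt N)"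
      by (simp add: P_def vec_eq_iff diff_divide_distrib)
    then have "norm (P h - P k) = sqrt (N * ((h - k) / sqrt N)\<^sup>2)"
      by (simp add: norm_eq_sqrt_inner vv)
    also have "\<dots> = \<bar>h - k\<bar>"
      using N by (simp add: power_divide)
    finally show ?thesis .
  qed
  have "\<forall>\<^sub>F f in unit_maps. \<forall>i j. i \<noteq> j \<longrightarrow> norm (f (q i) - f (q j)) = sqrt 2 * \<beta>"
    by (intro eventually_all_finite) (use goodD[OF beta(2) Fq Fq qq] in \<open>auto simp: eventually_conj_iff\<close>)
  moreover have "\<forall>\<^sub>F f in unit_maps. \<forall>i. norm (f (P h) - f (q i)) = sqrt (h\<^sup>2 + \<beta>\<^sup>2 * (1 - 1 / CARD('n)))"
    by (intro eventually_all_finite goodD[OF h] Pq FP Fq hk)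
  moreover have "\<forall>\<^sub>F f in unit_maps. \<forall>i. norm (f (P k) - f (q i)) = sqrt (k\<^sup>2 + \<beta>\<^sup>2 * (1 - 1 / CARD('n)))"
    by (intro eventually_all_finite goodD[OF k] Pq FP Fq hk)
  ultimately have "\<forall>\<^sub>F f in unit_maps.
    norm (f (P h) - f (P k)) = \<bar>h - k\<bar> \<or> norm (f (P h) - f (P k)) = \<bar>h + k\<bar>"
  proof eventually_elim
    case (elim f)
    have nonneg: "0 \<le> t\<^sup>2 + \<beta>\<^sup>2 * (1 - 1 / real CARD('n))" for t
      by simp
    show ?case
      by (rule dist_simplex_apexes[OF beta(1) hk(1), of "\<lambda>i. f (q i)"])
        (use elim nonneg in \<open>auto simp: power_mult_distrib\<close>)
  qed
  then show ?thesis
    using eventually_unit_maps_transfer[OF FP FP xy(1,2), of h k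
        "\<lambda>t. t = \<bar>h - k\<bar> \<or> t = \<bar>h + k\<bar>"] hk PP xy(3) by simp
qed

section \<open>Good distances\<close>

text \<open>The number is the distance \<open>r\<close> between mirror-image apexes at distance 1
  from all vertices of a unit simplex, so \<open>r\<close> can only become \<open>r\<close> or 0.
  Collapse is excluded by a triangle with sides \<open>r\<close>, \<open>r\<close>, 1: collapsing
  one long side would give the other length 1, which is neither 0 nor \<open>r\<close>.\<close>

lemma good_simplex_reflection:
  assumes n: "CARD('n::finite) > 1"
  shows "good TYPE('n) (sqrt (2 * (1 + 1 / CARD('n))))"
proof -
  define N where "N = real CARD('n)"
  have N: "N > 1" using n by (simp add: N_def)
  define r where "r = sqrt (2 * (1 + 1 / N))"
  define h where "h = r / 2"
  have r2: "r\<^sup>2 = 2 * (1 + 1 / N)" using N by (simp add: r_def)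
  have FN: "N \<in> constructible" by (simp add: N_def)
  have r: "r > 1" "r \<in> constructible"
    using N FN by (auto simp: r_def intro!: constructible_intros add_pos_pos)
  have h: "h > 0" "h \<in> constructible"
    using r by (auto simp: h_def intro!: constructible_intros)
  \<comment> \<open>With \<open>\<beta> = 1 / sqrt 2\<close> the simplex has edge 1, and heights
    \<open>h\<close> and \<open>-h\<close> put both apexes at distance 1 from its vertices.\<close>
  have "h\<^sup>2 + (1 / sqrt 2)\<^sup>2 * (1 - 1 / N) = 1"
    using N by (simp add: h_def power_divide r2 field_simps)
  then have one: "sqrt (h\<^sup>2 + (1 / sqrt 2)\<^sup>2 * (1 - 1 / real CARD('n))) = 1"
    by (simp add: N_def)
  have apex: "\<forall>\<^sub>F f in unit_maps. norm (f x - f y) = r \<or> norm (f x - f y) = 0"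
    if "x \<in> constructible_points" "y \<in> constructible_points" "norm (x - y) = r"
    for x y :: "real ^ 'n"
    using eventually_simplex_apexes[of "1 / sqrt 2" h "-h" x y] h one that good_1
    by (simp add: constructible_minus h_def)
  obtain y z :: "real ^ 'n" where yz: "y \<in> constructible_points" "z \<in> constructible_points"
    "norm (y - z) = 1"
    by (rule obtain_constructible_pair[of 1]) auto
  obtain x where x: "x \<in> constructible_points" "norm (y - x) = r" "norm (z - x) = r"
    using constructible_isosceles[OF n yz(1,2) r(2)] yz(3) r(1) by auto
  have "\<forall>\<^sub>F f in unit_maps. norm (f y - f x) = r"
    using apex[OF yz(1) x(1,2)] apex[OF yz(2) x(1,3)] goodD[OF good_1 yz]
    by eventually_elim (use r(1) in \<open>auto simp: norm_minus_commute\<close>)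
  then show ?thesis
    using goodI[OF _ yz(1) x(1,2)] r(1) by (simp add: r_def N_def)
qed

text \<open>With \<open>n = CARD('n)\<close>, a segment of length \<open>2 / n\<close> joins the two unit apexes over a regular
  simplex of edge \<open>r = sqrt (2 * (n + 1) / n)\<close>, hence is never stretched.
  Since \<open>r\<^sup>2 = (n + 1) * (2 / n)\<close> is good, chaining such segments makes \<open>n * (2 / n)\<close> good.\<close>

lemma good_2:
  assumes n: "CARD('n::finite) > 1"
  shows "good TYPE('n) 2"
proof -
  define N where "N = real CARD('n)"
  have N: "N > 1" using n by (simp add: N_def)
  define r where "r = sqrt (2 * (1 + 1 / N))"
  have r: "good TYPE('n) r" using good_simplex_reflection[OF n] by (simp add: r_def N_def)
  have r2: "r * r = 2 * (1 + 1 / N)" using N by (simp add: r_def)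
  define \<beta> where "\<beta> = r / sqrt 2"
  have \<beta>: "\<beta> > 0" "sqrt 2 * \<beta> = r" "\<beta>\<^sup>2 = 1 + 1 / N"
    using good_pos[OF r] r2 by (simp_all add: \<beta>_def power2_eq_square)
  \<comment> \<open>Over the simplex of edge \<open>r\<close>, heights \<open>1 / N\<close> and
    \<open>- (1 / N)\<close> give unit apexes.\<close>
  have "(1 / N)\<^sup>2 + \<beta>\<^sup>2 * (1 - 1 / N) = 1"
    using N unfolding \<beta>(3) by (simp add: power2_eq_square field_simps)
  then have one: "sqrt ((1 / N)\<^sup>2 + \<beta>\<^sup>2 * (1 - 1 / CARD('n))) = 1" by (simp add: N_def)
  have FN: "N \<in> constructible" by (simp add: N_def)
  have FN': "1 / N \<in> constructible" using FN by (simp add: constructible_divide)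
  have step: "\<forall>\<^sub>F f in unit_maps. norm (f x - f y) \<le> 2 / N"
    if "x \<in> constructible_points" "y \<in> constructible_points" "norm (x - y) = 2 / N"
    for x y :: "real ^ 'n"
  proof -
    have "\<forall>\<^sub>F f in unit_maps. norm (f x - f y) = \<bar>1 / N - (- (1 / N))\<bar> \<or>
        norm (f x - f y) = \<bar>1 / N + (- (1 / N))\<bar>"
      by (rule eventually_simplex_apexes[of \<beta>])
        (use \<beta> r N FN' one that good_1[where 'n = 'n] in \<open>auto intro: constructible_minus\<close>)
    then show ?thesis
      by eventually_elim (use N in auto)
  qed
  define p :: "nat \<Rightarrow> real ^ 'n" where "p m = axis undefined (m * (2 / N))" for m
  have Fp: "p m \<in> constructible_points" for m
    unfolding p_def using FN by (intro constructible_points_axis constructible_intros) auto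
  have pp: "norm (p l - p m) = \<bar>real l - real m\<bar> * (2 / N)" for l m
  proof -
    have "p l - p m = axis undefined ((real l - real m) * (2 / N))"
      by (simp add: p_def axis_def vec_eq_iff diff_divide_distrib left_diff_distrib)
    then have "norm (p l - p m) = \<bar>(real l - real m) * (2 / N)\<bar>"
      by (simp only: norm_axis)
    then show ?thesis using N by (simp only: abs_mult) simp
  qed
  have chain: "\<forall>\<^sub>F f in unit_maps. norm (f (p 0) - f (p m)) \<le> m * (2 / N)" for m
  proof (induction m)
    case (Suc m)
    have "\<forall>\<^sub>F f in unit_maps. norm (f (p m) - f (p (Suc m))) \<le> 2 / N"
      by (intro step Fp) (simp add: pp)
    with Suc show ?case
    proof eventually_elim
      case (elim f)
      then show ?case
        using norm_triangle_ineq[of "f (p 0) - f (p m)" "f (p m) - f (p (Suc m))"]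
        by (simp add: algebra_simps add_divide_distrib)
    qed
  qed simp
  let ?n = "CARD('n)"
  have two: "?n * (2 / N) = 2" using N by (simp add: N_def)
  have "norm (p 0 - p (Suc ?n)) = r * r"
    using N unfolding pp r2 by (simp add: field_simps N_def)
  then have "\<forall>\<^sub>F f in unit_maps. norm (f (p 0) - f (p (Suc ?n))) = r * r"
    by (intro goodD[OF good_mult[OF r r]] Fp)
  moreover have "\<forall>\<^sub>F f in unit_maps. norm (f (p ?n) - f (p (Suc ?n))) \<le> 2 / N"
    by (intro step Fp) (simp add: pp)
  moreover note chain[of ?n]
  \<comment> \<open>A squeeze: the chain bounds the distance above by 2, while the total
    \<open>r * r\<close> minus the last segment bounds it below by 2.\<close>
  ultimately have "\<forall>\<^sub>F f in unit_maps. norm (f (p 0) - f (p ?n)) = 2"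
  proof eventually_elim
    case (elim f)
    then show ?case
      using norm_triangle_ineq[of "f (p 0) - f (p ?n)" "f (p ?n) - f (p (Suc ?n))"] two
      unfolding r2 by simp
  qed
  moreover have "norm (p 0 - p ?n) = 2" using two by (simp add: pp)
  ultimately show ?thesis
    by (intro goodI[of 2 "p 0" "p ?n"] Fp) auto
qed

section \<open>Medians and Pythagorean closure\<close>

text \<open>The parallelogram law turns the first three equations into \<open>u + v = 0\<close>, so
  \<open>m\<close> is the midpoint; the median of the isosceles triangle follows.\<close>

lemma norm_median:
  fixes p q m x :: "'a::real_inner"
  assumes "norm (p - m) = b" "norm (q - m) = b" "norm (p - q) = 2 * b"
    and "norm (x - p) = a" "norm (x - q) = a"
  shows "norm (x - m) = sqrt (a\<^sup>2 - b\<^sup>2)"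
proof -
  define u v y where "u = p - m" and "v = q - m" and "y = x - m"
  have uv: "p - q = u - v" "x - p = y - u" "x - q = y - v" by (simp_all add: u_def v_def y_def)
  have u: "u \<bullet> u = b\<^sup>2" "v \<bullet> v = b\<^sup>2"
    using assms(1,2) by (simp_all add: u_def v_def flip: power2_norm_eq_inner)
  have d: "(u - v) \<bullet> (u - v) = (2 * b)\<^sup>2"
    using assms(3) by (simp add: uv flip: power2_norm_eq_inner)
  then have "(u + v) \<bullet> (u + v) = 0"
    using u by (simp add: inner_diff_left inner_diff_right inner_add_left inner_add_right
        inner_commute power2_eq_square)
  then have v: "v = - u" by (simp add: eq_neg_iff_add_eq_0 add.commute)
  have "(y - u) \<bullet> (y - u) = a\<^sup>2" "(y - v) \<bullet> (y - v) = a\<^sup>2"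
    using assms(4,5) by (simp_all add: uv flip: power2_norm_eq_inner)
  then have "y \<bullet> y = a\<^sup>2 - b\<^sup>2"
    using u unfolding v by (simp add: inner_diff_left inner_diff_right inner_add_left
        inner_add_right inner_commute)
  then show ?thesis by (simp add: norm_eq_sqrt_inner flip: y_def)
qed

text \<open>Take an isosceles triangle with legs \<open>a\<close> and base \<open>2 * b\<close>,
  together with the midpoint of its base. All distances used by the median computation are good, so
  it applies to the image as well.\<close>

lemma good_sqrt_diff_squares:
  assumes n: "CARD('n::finite) > 1"
    and a: "good TYPE('n) a" and b: "good TYPE('n) b" and "b < a"
  shows "good TYPE('n) (sqrt (a\<^sup>2 - b\<^sup>2))"
proof -
  note pos = good_pos[OF a] good_pos[OF b] and F = good_constructible[OF a] good_constructible[OF b]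
  define p q :: "real ^ 'n" where "p = axis undefined b" and "q = axis undefined (- b)"
  have Fpq: "p \<in> constructible_points" "q \<in> constructible_points"
    using F by (auto simp: p_def q_def intro!: constructible_points_axis constructible_minus)
  have "p - q = axis undefined (2 * b)"
    by (simp add: p_def q_def axis_def vec_eq_iff)
  then have npq: "norm (p - 0) = b" "norm (q - 0) = b" "norm (p - q) = 2 * b"
    using pos by (simp_all add: p_def q_def norm_axis)
  obtain x where x: "x \<in> constructible_points" "norm (p - x) = a" "norm (q - x) = a"
    using constructible_isosceles[OF n Fpq F(1)] npq(3) \<open>b < a\<close> by auto
  have nx: "norm (x - p) = a" "norm (x - q) = a"
    using x(2,3) by (simp_all add: norm_minus_commute)
  have "\<forall>\<^sub>F f in unit_maps. norm (f p - f 0) = b"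
    "\<forall>\<^sub>F f in unit_maps. norm (f q - f 0) = b"
    "\<forall>\<^sub>F f in unit_maps. norm (f p - f q) = 2 * b"
    "\<forall>\<^sub>F f in unit_maps. norm (f x - f p) = a"
    "\<forall>\<^sub>F f in unit_maps. norm (f x - f q) = a"
    using goodD[OF b] goodD[OF a] goodD[OF good_mult[OF good_2[OF n] b]] Fpq npq nx x(1) by auto
  then have "\<forall>\<^sub>F f in unit_maps. norm (f x - f 0) = sqrt (a\<^sup>2 - b\<^sup>2)"
    by eventually_elim (rule norm_median)
  moreover have "norm (x - 0) = sqrt (a\<^sup>2 - b\<^sup>2)"
    by (rule norm_median[OF npq nx])
  moreover have "sqrt (a\<^sup>2 - b\<^sup>2) > 0"
    using pos \<open>b < a\<close> by (simp add: power_strict_mono)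
  ultimately show ?thesis
    by (intro goodI[of _ x 0] x) auto
qed

text \<open>Powers of 2 are good. A large good length reduces sums to differences and inverses to
  contractions.\<close>

lemma good_unbounded:
  assumes "CARD('n::finite) > 1"
  obtains K where "good TYPE('n) K" "K > t"
proof -
  have "good TYPE('n) (2 ^ m)" for m
    by (induction m) (simp_all add: good_1 good_mult good_2[OF assms])
  moreover obtain m where "t < 2 ^ m" using real_arch_pow[of 2 t] by auto
  ultimately show ?thesis using that by blast
qed

text \<open>Three leg constructions suffice: subtract the squares of \<open>a\<close> and
  \<open>b\<close> from that of \<open>K\<close>, then subtract the rest from the square of
  \<open>K\<close> again. \<open>K > a + b\<close> keeps every radicand positive.\<close>

lemma good_sqrt_sum_squares:
  assumes n: "CARD('n::finite) > 1"
    and a: "good TYPE('n) a" and b: "good TYPE('n) b"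
  shows "good TYPE('n) (sqrt (a\<^sup>2 + b\<^sup>2))"
proof -
  note pos = good_pos[OF a] good_pos[OF b]
  obtain K where K: "good TYPE('n) K" "K > a + b" using good_unbounded[OF n] .
  have "(a + b)\<^sup>2 < K\<^sup>2" using K pos by (intro power_strict_mono) auto
  moreover have "a\<^sup>2 + b\<^sup>2 < (a + b)\<^sup>2" using pos by (simp add: power2_sum)
  ultimately have K2: "a\<^sup>2 + b\<^sup>2 < K\<^sup>2" by linarith
  define c where "c = sqrt (K\<^sup>2 - a\<^sup>2)"
  have a2: "0 < a\<^sup>2" "0 < b\<^sup>2" using pos by simp_all
  have c2: "c\<^sup>2 = K\<^sup>2 - a\<^sup>2" using K2 a2(2) unfolding c_def by (intro real_sqrt_pow2) linarith
  have c: "good TYPE('n) c"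
    unfolding c_def using K(2) pos by (intro good_sqrt_diff_squares n K(1) a) auto
  have "b < c" unfolding c_def using K2 by (intro real_less_rsqrt) linarith
  define d where "d = sqrt (c\<^sup>2 - b\<^sup>2)"
  have d: "good TYPE('n) d"
    unfolding d_def by (intro good_sqrt_diff_squares n c b \<open>b < c\<close>)
  have "d\<^sup>2 = c\<^sup>2 - b\<^sup>2"
    unfolding d_def using K2 c2 by (intro real_sqrt_pow2) linarith
  then have d2: "K\<^sup>2 - d\<^sup>2 = a\<^sup>2 + b\<^sup>2" using c2 by linarith
  have "d\<^sup>2 < K\<^sup>2" using d2 a2 by linarith
  then have "d < K" by (rule power2_less_imp_less) (use good_pos[OF K(1)] in simp)
  from good_sqrt_diff_squares[OF n K(1) d this] show ?thesis unfolding d2 .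
qed

lemma good_sqrt_of_nat:
  assumes n: "CARD('n::finite) > 1" and "m > 0"
  shows "good TYPE('n) (sqrt (real m))"
  using \<open>m > 0\<close>
proof (induction m rule: nat_induct_non_zero)
  case (Suc m)
  from good_sqrt_sum_squares[OF n good_1 Suc(2)] show ?case by simp
qed (simp add: good_1)

section \<open>Similar triangles and contraction\<close>

text \<open>Equality in the triangle inequality puts \<open>x'\<close> and \<open>y'\<close> on the
  segments from \<open>z\<close>, so they are images of \<open>x\<close> and \<open>y\<close> under
  a homothety centred at \<open>z\<close>.\<close>

lemma norm_similar_triangles:
  fixes z x y x' y' :: "'a::real_inner"
  assumes "s > 0" "t > 0"
    and "norm (z - x') = s" "norm (x' - x) = t" "norm (z - x) = s + t"
    and "norm (z - y') = s" "norm (y' - y) = t" "norm (z - y) = s + t"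
  shows "norm (x' - y') = s / (s + t) * norm (x - y)"
proof -
  have between: "(s + t) *\<^sub>R w' = t *\<^sub>R z + s *\<^sub>R w"
    if "norm (z - w') = s" "norm (w' - w) = t" "norm (z - w) = s + t" for w w'
  proof -
    have "s *\<^sub>R (w' - w) = t *\<^sub>R (z - w')"
      using dist_triangle_eq[of z w w'] that by (simp add: dist_norm)
    then show ?thesis by (simp add: algebra_simps)
  qed
  have "(s + t) *\<^sub>R (x' - y') = s *\<^sub>R (x - y)"
    using between[OF assms(3-5)] between[OF assms(6-8)] by (simp add: scaleR_diff_right)
  then have "norm ((s + t) *\<^sub>R (x' - y')) = norm (s *\<^sub>R (x - y))" by simp
  then show ?thesis unfolding norm_scaleR using assms(1,2) by (simp add: field_simps)
qed

text \<open>The bound on \<open>d\<close> is what an isosceles triangle with base \<open>d\<close>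
  and legs \<open>s + t\<close> requires. Its sides and the subdivisions of its legs are good, so
  the image is again a pair of similar triangles.\<close>

lemma good_contract:
  assumes n: "CARD('n::finite) > 1"
    and s: "good TYPE('n) s" and t: "good TYPE('n) t" and st: "good TYPE('n) (s + t)"
    and d: "good TYPE('n) d" "d \<le> 2 * (s + t)"
  shows "good TYPE('n) (s / (s + t) * d)"
proof -
  note pos = good_pos[OF s] good_pos[OF t] good_pos[OF d(1)]
  note F = good_constructible[OF s] good_constructible[OF t] good_constructible[OF st]
  obtain x y :: "real ^ 'n" where xy: "x \<in> constructible_points" "y \<in> constructible_points"
    "norm (x - y) = d"
    using obtain_constructible_pair[of d] good_constructible[OF d(1)] pos by (metis less_imp_le)
  obtain z where z: "z \<in> constructible_points" "norm (x - z) = s + t" "norm (y - z) = s + t"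
    using constructible_isosceles[OF n xy(1,2) F(3)] xy(3) d(2) by auto
  define k where "k = s / (s + t)"
  have k: "k \<in> constructible" "k > 0" "1 - k > 0" "k * (s + t) = s" "(1 - k) * (s + t) = t"
    unfolding k_def using F pos by (auto simp: field_simps intro!: constructible_divide)
  define c where "c w = z + k *\<^sub>R (w - z)" for w
  have c: "norm (z - c w) = s \<and> norm (c w - w) = t" if "norm (w - z) = s + t" for w
  proof -
    have "c w - z = k *\<^sub>R (w - z)" "w - c w = (1 - k) *\<^sub>R (w - z)"
      by (simp_all add: c_def scaleR_diff_left)
    then have "norm (c w - z) = s" "norm (w - c w) = t"
      using k that by simp_all
    then show ?thesis by (metis norm_minus_commute)
  qed
  have Fc: "c w \<in> constructible_points" if "w \<in> constructible_points" for w
    unfolding c_def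
    by (intro constructible_points_add constructible_points_scaleR constructible_points_diff that z(1) k(1))
  have cx: "norm (z - c x) = s" "norm (c x - x) = t" using c[OF z(2)] by auto
  have cy: "norm (z - c y) = s" "norm (c y - y) = t" using c[OF z(3)] by auto
  have nz: "norm (z - x) = s + t" "norm (z - y) = s + t" using z by (simp_all add: norm_minus_commute)
  have eq: "norm (c x - c y) = s / (s + t) * d"
    using norm_similar_triangles[OF pos(1,2) cx nz(1) cy nz(2)] xy(3) by simp
  from goodD[OF s z(1) Fc[OF xy(1)] cx(1)] goodD[OF t Fc[OF xy(1)] xy(1) cx(2)]
    goodD[OF st z(1) xy(1) nz(1)] goodD[OF s z(1) Fc[OF xy(2)] cy(1)]
    goodD[OF t Fc[OF xy(2)] xy(2) cy(2)] goodD[OF st z(1) xy(2) nz(2)] goodD[OF d(1) xy]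
  have "\<forall>\<^sub>F f in unit_maps. norm (f (c x) - f (c y)) = s / (s + t) * d"
  proof eventually_elim
    case (elim f)
    from norm_similar_triangles[OF pos(1,2) elim(1-6)] elim(7) show ?case by simp
  qed
  then show ?thesis
    using pos by (intro goodI[OF _ Fc[OF xy(1)] Fc[OF xy(2)] eq]) auto
qed

text \<open>This is the midline of a triangle with legs 2 and base 1.\<close>

lemma good_half:
  assumes n: "CARD('n::finite) > 1"
  shows "good TYPE('n) (1 / 2)"
proof -
  have "good TYPE('n) (1 / (1 + 1) * 1)"
    by (rule good_contract[OF n good_1 good_1 _ good_1]) (simp_all add: good_2[OF n])
  then show ?thesis by simp
qed

section \<open>Field operations and square roots\<close>

text \<open>Two apexes over a simplex at heights \<open>a\<close> and \<open>b\<close> can only be mapped to distance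
  \<open>a - b\<close> or \<open>a + b\<close>; a path of two segments of length \<open>sqrt (a\<^sup>2 + b\<^sup>2) / 2\<close>
  excludes the latter.\<close>

lemma good_diff:
  assumes n: "CARD('n::finite) > 1"
    and a: "good TYPE('n) a" and b: "good TYPE('n) b" and "b < a"
  shows "good TYPE('n) (a - b)"
proof -
  define N where "N = real CARD('n)"
  have N: "N > 1" using n by (simp add: N_def)
  note pos = good_pos[OF a] good_pos[OF b] and F = good_constructible[OF a] good_constructible[OF b]
  \<comment> \<open>The choice \<open>\<beta> = sqrt N\<close> makes the squared circumradius the
    integer \<open>N - 1\<close> and the edge \<open>sqrt (2 * N)\<close>, so good heights give good
    apex-to-vertex distances.\<close>
  have height: "good TYPE('n) (sqrt (h\<^sup>2 + (sqrt N)\<^sup>2 * (1 - 1 / CARD('n))))"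
    if "good TYPE('n) h" for h
  proof -
    have "(sqrt N)\<^sup>2 * (1 - 1 / CARD('n)) = real (CARD('n) - 1)"
      using n by (simp add: N_def field_simps of_nat_diff)
    then show ?thesis
      using good_sqrt_sum_squares[OF n that good_sqrt_of_nat[OF n, of "CARD('n) - 1"]] n by simp
  qed
  obtain x y :: "real ^ 'n" where xy: "x \<in> constructible_points" "y \<in> constructible_points"
    "norm (x - y) = a - b"
    using obtain_constructible_pair[of "a - b"] constructible.diff[OF F] \<open>b < a\<close>
    by (metis diff_ge_0_iff_ge less_imp_le)
  define g where "g = 1 / 2 * sqrt (a\<^sup>2 + b\<^sup>2)"
  have g: "good TYPE('n) g"
    unfolding g_def by (intro good_mult good_half good_sqrt_sum_squares n a b)
  have "sqrt (a\<^sup>2 + b\<^sup>2) \<ge> a - b"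
    using pos by (intro real_le_rsqrt) (simp add: power2_diff)
  moreover have "sqrt (a\<^sup>2 + b\<^sup>2) < a + b"
    using pos by (intro real_less_lsqrt) (simp_all add: power2_sum)
  \<comment> \<open>The lower bound on \<open>2 * g\<close> makes the middle point \<open>z\<close>
    exist; the strict upper bound excludes distance \<open>a + b\<close>.\<close>
  ultimately have g2: "a - b \<le> 2 * g" "2 * g < a + b" by (simp_all add: g_def)
  obtain z where z: "z \<in> constructible_points" "norm (x - z) = g" "norm (y - z) = g"
    using constructible_isosceles[OF n xy(1,2) good_constructible[OF g]] g2(1) xy(3) by auto
  have "sqrt 2 * sqrt N = sqrt (real (2 * CARD('n)))"
    by (simp add: N_def real_sqrt_mult)
  then have \<beta>: "good TYPE('n) (sqrt 2 * sqrt N)" using good_sqrt_of_nat[OF n, of "2 * CARD('n)"] by simp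
  have "\<forall>\<^sub>F f in unit_maps. norm (f x - f y) = \<bar>a - b\<bar> \<or> norm (f x - f y) = \<bar>a + b\<bar>"
  proof (rule eventually_simplex_apexes[OF _ \<beta> _ F height[OF a] height[OF b] xy(1,2)])
    show "sqrt N > 0" "a \<noteq> 0" "norm (x - y) = \<bar>a - b\<bar>"
      using N pos xy(3) \<open>b < a\<close> by auto
  qed
  with goodD[OF g xy(1) z(1,2)] goodD[OF g xy(2) z(1,3)]
  have "\<forall>\<^sub>F f in unit_maps. norm (f x - f y) = a - b"
  proof eventually_elim
    case (elim f)
    then show ?case
      using norm_triangle_ineq4[of "f x - f z" "f y - f z"] g2 pos \<open>b < a\<close> by auto
  qed
  then show ?thesis
    using xy \<open>b < a\<close> by (intro goodI[of _ x y]) auto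
qed

text \<open>Write \<open>a + b = K - ((K - a) - b)\<close> with a large good
  \<open>K\<close>.\<close>

lemma good_add:
  assumes n: "CARD('n::finite) > 1"
    and a: "good TYPE('n) a" and b: "good TYPE('n) b"
  shows "good TYPE('n) (a + b)"
proof -
  note pos = good_pos[OF a] good_pos[OF b]
  obtain K where K: "good TYPE('n) K" "K > a + b" using good_unbounded[OF n] .
  have "good TYPE('n) (K - a)" using K pos by (intro good_diff[OF n _ a]) auto
  then have "good TYPE('n) (K - a - b)" using K by (intro good_diff[OF n _ b]) auto
  then have "good TYPE('n) (K - (K - a - b))" using pos by (intro good_diff[OF n K(1)]) auto
  then show ?thesis by simp
qed

text \<open>Contraction with \<open>s = 1\<close> and \<open>s + t = K * a\<close> makes
  \<open>1 / (K * a)\<close> good; multiplication by \<open>K\<close> finishes. Large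
  \<open>K\<close> keeps \<open>t\<close> positive.\<close>

lemma good_inverse:
  assumes n: "CARD('n::finite) > 1" and a: "good TYPE('n) a"
  shows "good TYPE('n) (inverse a)"
proof -
  note pos = good_pos[OF a]
  obtain K where K: "good TYPE('n) K" "K > inverse a" using good_unbounded[OF n] .
  have gt: "K * a > 1" using K pos by (simp add: field_simps)
  have "good TYPE('n) (K * a - 1)" using gt by (intro good_diff good_mult good_1 n K a)
  then have "good TYPE('n) (1 / (1 + (K * a - 1)) * 1)"
    using gt by (intro good_contract n good_1) (simp_all add: good_mult K a)
  then have "good TYPE('n) (K * (1 / (K * a)))"
    by (intro good_mult K) simp
  moreover have "K * (1 / (K * a)) = inverse a"
    using good_pos[OF K(1)] pos by (simp add: field_simps)
  ultimately show ?thesis by simp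
qed

text \<open>The right triangle needs \<open>(a - 1) / 2\<close> positive; values below 1 are handled
  through their inverse.\<close>

lemma good_sqrt:
  assumes n: "CARD('n::finite) > 1" and a: "good TYPE('n) a"
  shows "good TYPE('n) (sqrt a)"
proof -
  have *: "good TYPE('n) (sqrt a)" if a: "good TYPE('n) a" and "a > 1" for a
  proof -
    have "good TYPE('n) ((a + 1) * (1 / 2))" "good TYPE('n) ((a - 1) * (1 / 2))"
      by (intro good_mult good_half good_add good_diff good_1 n a \<open>a > 1\<close>)+
    from good_sqrt_diff_squares[OF n this] have
      "good TYPE('n) (sqrt (((a + 1) * (1 / 2))\<^sup>2 - ((a - 1) * (1 / 2))\<^sup>2))" by simp
    moreover have "((a + 1) * (1 / 2))\<^sup>2 - ((a - 1) * (1 / 2))\<^sup>2 = a"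
      by (simp add: power2_eq_square field_simps)
    ultimately show ?thesis by simp
  qed
  consider "a > 1" | "a = 1" | "a < 1" by linarith
  then show ?thesis
  proof cases
    case 3
    then have "inverse a > 1" using good_pos[OF a] by (simp add: one_less_inverse)
    from good_inverse[OF n *[OF good_inverse[OF n a] this]] show ?thesis
      by (simp add: real_sqrt_inverse)
  qed (use * a in \<open>auto simp: good_1\<close>)
qed

text \<open>Good distances are positive, so the induction runs on absolute values with 0 set apart;
  \<open>\<bar>a - b\<bar>\<close> is a sum or a difference of absolute values according to the
  signs.\<close>

lemma good_abs_constructible:
  assumes n: "CARD('n::finite) > 1" and "a \<in> constructible"
  shows "a = 0 \<or> good TYPE('n) \<bar>a\<bar>"
  using \<open>a \<in> constructible\<close>
proof induction
  case one
  then show ?case by (simp add: good_1)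
next
  case (diff a b)
  show ?case
  proof (cases "a = 0 \<or> b = 0")
    case True
    then show ?thesis using diff.IH by auto
  next
    case False
    then have ab: "good TYPE('n) \<bar>a\<bar>" "good TYPE('n) \<bar>b\<bar>" using diff.IH by auto
    consider "a = b" | "\<bar>a - b\<bar> = \<bar>a\<bar> - \<bar>b\<bar>" "\<bar>b\<bar> < \<bar>a\<bar>"
      | "\<bar>a - b\<bar> = \<bar>b\<bar> - \<bar>a\<bar>" "\<bar>a\<bar> < \<bar>b\<bar>" | "\<bar>a - b\<bar> = \<bar>a\<bar> + \<bar>b\<bar>"
      by arith
    then show ?thesis
      by cases (use ab good_diff[OF n] good_add[OF n] in auto)
  qed
next
  case (mult a b)
  then show ?case by (auto simp: abs_mult good_mult)
next
  case (inverse a)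
  then show ?case using good_inverse[OF n, of "\<bar>a\<bar>"] by (auto simp: abs_inverse)
next
  case (sqrt a)
  then show ?case using good_sqrt[OF n, of a] by auto
qed

theorem theorem2:
  fixes x y :: "real ^ 'n::finite"
  assumes "CARD('n) > 1"
    and "x \<in> constructible_points"
    and "y \<in> constructible_points"
  shows "\<exists>S. finite S \<and> S \<subseteq> constructible_points \<and> x \<in> S \<and> y \<in> S \<and>
           (\<forall>f :: real ^ 'n \<Rightarrow> real ^ 'n.
              preserves_unit_distances S f \<longrightarrow> norm (f x - f y) = norm (x - y))"
proof -
  have "norm (x - y) = 0 \<or> good TYPE('n) (norm (x - y))"
    using good_abs_constructible[OF assms(1) constructible_norm[OF constructible_points_diff[OF assms(2,3)]]]
    by simp
  then have "\<forall>\<^sub>F f in unit_maps. norm (f x - f y) = norm (x - y)"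
    using goodD[OF _ assms(2,3)] by auto
  then obtain S where S: "finite S" "S \<subseteq> constructible_points"
    "\<And>f. preserves_unit_distances S f \<Longrightarrow> norm (f x - f y) = norm (x - y)"
    by (auto simp: eventually_unit_maps)
  \<comment> \<open>Enlarging the forcing set by \<open>x\<close> and \<open>y\<close> only
    strengthens the assumption on \<open>f\<close>.\<close>
  have "norm (f x - f y) = norm (x - y)" if "preserves_unit_distances (S \<union> {x, y}) f" for f
    using that by (intro S(3)) (auto simp: preserves_unit_distances_def)
  then show ?thesis
    using S(1,2) assms(2,3) by (intro exI[of _ "S \<union> {x, y}"]) auto
qed

end
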